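(* Let $\phi$ be an affine equivariant integrator map, let $F\colon Y\to Z$ be a Gâteaux differentiable map between Banach spaces, let $f\in\mathfrak{X}(Y)$, and let $g\in\mathfrak{X}(Y\times Z)$ be the augmented vector field $g(y,z)=\bigl(f(y),F'(y)f(y)\bigr)$. Write $\widetilde f=\phi(f)$ and $\widetilde g=\phi(g)$. Then $\widetilde g(\widetilde y,\widetilde z)=\widetilde g\bigl(\widetilde y,F(\widetilde y)\bigr)$ for all $(\widetilde y,\widetilde z)\in Y\times Z$. Consequently, the condition $$\widetilde g\bigl(\widetilde y,F(\widetilde y)\bigr)=\bigl(\widetilde f(\widetilde y),F'(\widetilde y)\widetilde f(\widetilde y)\bigr)\quad\text{for all }\widetilde y\in Y$$ holds if and only if $\widetilde g(\widetilde y,\widetilde z)=\bigl(\widetilde f(\widetilde y),F'(\widetilde y)\widetilde f(\widetilde y)\bigr)$ for all $(\widetilde y,\widetilde z)\in Y\times Z$.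
   Context: All spaces are real Banach spaces; $\mathfrak{X}(Y)$ denotes the set of smooth vector fields on $Y$ (smooth maps $Y\to Y$). An integrator map $\phi$ is a collection of smooth maps $\phi_Y\colon\mathfrak{X}(Y)\to\mathfrak{X}(Y)$, one for each Banach space $Y$; one writes $\phi(f)=\phi_Y(f)$. For a Gâteaux differentiable map $\chi\colon Y\to U$, vector fields $f\in\mathfrak{X}(Y)$ and $g\in\mathfrak{X}(U)$ are $\chi$-related, written $f\sim_\chi g$, if $\chi'(y)f(y)=g(\chi(y))$ for all $y\in Y$. An integrator map $\phi$ is affine equivariant if for every affine map $A\colon Y\to U$ between Banach spaces, $f\sim_A g$ implies $\phi(f)\sim_A\phi(g)$. *)

theory Defs
  imports "HOL-Analysis.Analysis"
begin

definition gateaux_differentiable :: "('a::real_normed_vector \<Rightarrow> 'b::real_normed_vector) \<Rightarrow> bool" where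
  "gateaux_differentiable F \<longleftrightarrow>
     (\<forall>y. \<exists>L. bounded_linear L \<and>
        (\<forall>v. ((\<lambda>t::real. inverse t *\<^sub>R (F (y + t *\<^sub>R v) - F y)) \<longlongrightarrow> L v) (at 0)))"

definition gderiv :: "('a::real_normed_vector \<Rightarrow> 'b::real_normed_vector) \<Rightarrow> 'a \<Rightarrow> 'a \<Rightarrow> 'b" where
  "gderiv F y v = Lim (at (0::real)) (\<lambda>t. inverse t *\<^sub>R (F (y + t *\<^sub>R v) - F y))"

definition related :: "('a::real_normed_vector \<Rightarrow> 'b::real_normed_vector) \<Rightarrow> ('a \<Rightarrow> 'a) \<Rightarrow> ('b \<Rightarrow> 'b) \<Rightarrow> bool" where
  "related chi f g \<longleftrightarrow> (\<forall>y. gderiv chi y (f y) = g (chi y))"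

definition affine_map :: "('a::real_normed_vector \<Rightarrow> 'b::real_normed_vector) \<Rightarrow> bool" where
  "affine_map A \<longleftrightarrow> (\<exists>L b. bounded_linear L \<and> (\<forall>x. A x = L x + b))"

text \<open>Affine equivariance of an integrator map, for the pair of spaces (Y,U) on which
  phi acts via phiY and phiU.\<close>
definition affine_equivariant_pair ::
  "(('a::real_normed_vector \<Rightarrow> 'a) \<Rightarrow> ('a \<Rightarrow> 'a)) \<Rightarrow> (('b::real_normed_vector \<Rightarrow> 'b) \<Rightarrow> ('b \<Rightarrow> 'b)) \<Rightarrow> bool" where
  "affine_equivariant_pair \<phi>Y \<phi>U \<longleftrightarrow>
     (\<forall>(A::'a \<Rightarrow> 'b) f g. affine_map A \<longrightarrow> related A f g \<longrightarrow> related A (\<phi>Y f) (\<phi>U g))"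

end

theory Submission
  imports Defs
begin

text \<open>The augmented field g does not depend on z, i.e. it is invariant under the translations
  (y, z) \<mapsto> (y, z + w). A translation is affine with identity derivative, so invariance
  of a vector field under it is the same as the field being related to itself; affine
  equivariance therefore passes the invariance on to \<phi>(g).\<close>

lemma gderiv_translation:
  fixes c :: "'a::real_normed_vector"
  shows "gderiv (\<lambda>p. p + c) y v = v"
proof -
  have "\<forall>\<^sub>F t in at (0::real). v = inverse t *\<^sub>R ((y + t *\<^sub>R v + c) - (y + c))"
    by (simp add: eventually_at_filter)
  then have "((\<lambda>t::real. inverse t *\<^sub>R ((y + t *\<^sub>R v + c) - (y + c))) \<longlongrightarrow> v) (at 0)"
    by (rule Lim_transform_eventually[OF tendsto_const])
  then show ?thesis
    unfolding gderiv_def by (intro tendsto_Lim) auto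
qed

lemma affine_map_translation: "affine_map (\<lambda>p. p + c)"
  unfolding affine_map_def using bounded_linear_ident by fastforce

lemma related_translation_iff: "related (\<lambda>p. p + c) f g \<longleftrightarrow> (\<forall>p. f p = g (p + c))"
  unfolding related_def gderiv_translation ..

lemma affine_equivariant_translation_invariant:
  assumes "affine_equivariant_pair \<phi> \<phi>"
    and "\<And>p. f (p + c) = f p"
  shows "\<phi> f (p + c) = \<phi> f p"
proof -
  have "related (\<lambda>p. p + c) f f"
    using assms(2) by (simp add: related_translation_iff)
  then have "related (\<lambda>p. p + c) (\<phi> f) (\<phi> f)"
    using assms(1) affine_map_translation unfolding affine_equivariant_pair_def by blast
  then show ?thesis
    by (simp add: related_translation_iff)
qed

theorem proposition2p5:
  fixes \<phi>Y :: "('a::banach \<Rightarrow> 'a) \<Rightarrow> ('a \<Rightarrow> 'a)"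
    and \<phi>YZ :: "('a \<times> 'b::banach \<Rightarrow> 'a \<times> 'b) \<Rightarrow> ('a \<times> 'b \<Rightarrow> 'a \<times> 'b)"
    and F :: "'a \<Rightarrow> 'b" and f :: "'a \<Rightarrow> 'a" and g :: "'a \<times> 'b \<Rightarrow> 'a \<times> 'b"
  assumes eq_Y_Y: "affine_equivariant_pair \<phi>Y \<phi>Y"
    and eq_Y_YZ: "affine_equivariant_pair \<phi>Y \<phi>YZ"
    and eq_YZ_Y: "affine_equivariant_pair \<phi>YZ \<phi>Y"
    and eq_YZ_YZ: "affine_equivariant_pair \<phi>YZ \<phi>YZ"
    and F_diff: "gateaux_differentiable F"
    and g_def: "\<And>y z. g (y, z) = (f y, gderiv F y (f y))"
  shows "(\<forall>y z. \<phi>YZ g (y, z) = \<phi>YZ g (y, F y))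
    \<and> ((\<forall>y. \<phi>YZ g (y, F y) = (\<phi>Y f y, gderiv F y (\<phi>Y f y)))
        \<longleftrightarrow> (\<forall>y z. \<phi>YZ g (y, z) = (\<phi>Y f y, gderiv F y (\<phi>Y f y))))"
proof -
  have g_invariant: "g (p + (0, w)) = g p" for p w
    by (cases p) (simp add: g_def)
  have "\<phi>YZ g (y, z) = \<phi>YZ g (y, F y)" for y z
    using affine_equivariant_translation_invariant[OF eq_YZ_YZ, of g "(0, F y - z)" "(y, z)"]
      g_invariant
    by simp
  then show ?thesis
    by metis
qed

end
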